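(* Let $Q(V_0)=R_1(V_1)\wedge\cdots\wedge R_m(V_m)$ be a conjunctive query (not necessarily acyclic or full) with variables $\mathbf V=\{X_1,\dots,X_n\}=V_1\cup\cdots\cup V_m$ and group-by variables $V_0\subseteq\mathbf V$, and let $\Sigma$ be a finite set of simple statistics for $Q$. Then the optimal values of the linear programs $\mathrm{LP}_{\mathrm{base}}(Q,\Sigma)$ and $\mathrm{LP}_{\mathrm{flow}}(Q,\Sigma)$ are equal.
   Context: **Statistics.** A simple statistic is a tuple $\sigma=(j,U,V,p,b)$ with $U,V\subseteq V_j$, $|U|\le1$, $p\in(0,\infty]$, and a real $b\ge1$; it represents the assertion $\|\deg_{R_j}(V|U)\|_p\le b$ on the $\ell_p$-norm of the degree sequence from $U$ to $V$ in $R_j$. Write $UV=U\cup V$, $h(V|U)=h(UV)-h(U)$; $\log$ is base 2; $1/\infty=0$. **$\mathrm{LP}_{\mathrm{base}}(Q,\Sigma)$.** Variables $h(U)\ge0$ for all $U\subseteq\mathbf V$. Maximize $h(V_0)$ subject to: $\frac1p h(U)+h(V|U)\le\log b$ for each $(j,U,V,p,b)\in\Sigma$; and the basic Shannon inequalities $h(\emptyset)=0$, $h(U\cup V)\ge h(U)$, $h(U)+h(V)\ge h(U\cup V)+h(U\cap V)$ for all $U,V\subseteq\mathbf V$. **Flow network.** $G=(\mathrm{Nodes},\mathrm{Edges})$. The nodes are the following subsets of $\mathbf V$: $\emptyset$ (the source), $\{X_i\}$ for every $i$, and $UV$ for every statistic $(j,U,V,p,b)\in\Sigma$. The edges are: -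 forward edges $(a,b)$ with $a\subsetneq b$: for each statistic, the edges $(\emptyset,U)$ and $(U,UV)$ (degenerate edges with equal endpoints are omitted); - backward edges $(a,b)$ with $b\subsetneq a$ and infinite capacity: for each statistic and each $X_i\in UV$, the edge $(UV,\{X_i\})$ (omitted if $UV=\{X_i\}$). **$\mathrm{LP}_{\mathrm{flow}}(Q,\Sigma)$.** Variables: $w_\sigma\ge0$ for each $\sigma\in\Sigma$, and flow variables $f_{a,b;X_i}\ge0$ for each $X_i\in V_0$ and each edge $(a,b)$. Minimize $\sum_{\sigma\in\Sigma}w_\sigma\log b_\sigma$ subject to, for every $X_i\in V_0$: - flow conservation: for every node $c\ne\emptyset$, $\sum_a f_{a,c;X_i}-\sum_b f_{c,b;X_i}\ge 1$ if $c=\{X_i\}$, and $\ge 0$ otherwise, where the sums range over edges $(a,c)$, respectively $(c,b)$; - flow capacity: $f_{a,b;X_i}\le c_{a,b}$ for every forward edge $(a,b)$, where - $c_{\emptyset,W}=\sum_{\sigma:\,U_\sigma=\emptyset,\,V_\sigma=W}w_\sigma+\sum_{\sigma:\,U_\sigma=W}\frac{w_\sigma}{p_\sigma}$ for $W\ne\emptyset$, - $c_{U,W}=\sum_{\sigma:\,U_\sigma=U,\ U_\sigma V_\sigma=W}w_\sigma$ for $U\ne\emptyset$, $W\neq U$. Here $U_\sigma,V_\sigma,p_\sigma,b_\sigma$ are the components of $\sigma$. The optimal value is $+\infty$ if a maximization is unbounded or a minimization is infeasible. *)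

theory Defs
  imports Complex_Main "HOL-Library.Extended_Real"
begin

text \<open>
  A conjunctive query \<open>Q(V\<^sub>0) = R\<^sub>1(V\<^sub>1) \<and> \<dots> \<and> R\<^sub>m(V\<^sub>m)\<close>. The atoms form a list, so a relation
  symbol or a variable set may be repeated; the atom indices are \<open>0, \<dots>, m - 1\<close>.
\<close>

record ('r, 'v) cquery =
  head :: "'v set"
  atoms :: "('r \<times> 'v set) list"

definition atom_vars :: "('r, 'v) cquery \<Rightarrow> nat \<Rightarrow> 'v set" where
  "atom_vars Q j = snd (atoms Q ! j)"

definition vars :: "('r, 'v) cquery \<Rightarrow> 'v set" where
  "vars Q = (\<Union>j<length (atoms Q). atom_vars Q j)"

definition conjunctive_query :: "('r, 'v) cquery \<Rightarrow> bool" where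
  "conjunctive_query Q \<longleftrightarrow>
     (\<forall>j<length (atoms Q). finite (atom_vars Q j)) \<and> head Q \<subseteq> vars Q"

text \<open>
  A statistic \<open>(j, U, V, p, b)\<close> stands for the bound \<open>b\<close> on the \<open>p\<close>-norm of the degree sequence
  from \<open>U\<close> to \<open>V\<close> in the \<open>j\<close>-th relation.
\<close>

record 'v statistic =
  st_atom :: nat
  st_U :: "'v set"
  st_V :: "'v set"
  st_p :: ereal
  st_b :: real

definition simple_statistic :: "('r, 'v) cquery \<Rightarrow> 'v statistic \<Rightarrow> bool" where
  "simple_statistic Q \<sigma> \<longleftrightarrow>
     st_atom \<sigma> < length (atoms Q) \<and>
     st_U \<sigma> \<subseteq> atom_vars Q (st_atom \<sigma>) \<and>
     st_V \<sigma> \<subseteq> atom_vars Q (st_atom \<sigma>) \<and>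
     card (st_U \<sigma>) \<le> 1 \<and> 0 < st_p \<sigma> \<and> 1 \<le> st_b \<sigma>"

abbreviation st_UV :: "'v statistic \<Rightarrow> 'v set" where
  "st_UV \<sigma> \<equiv> st_U \<sigma> \<union> st_V \<sigma>"

text \<open>The real number \<open>1 / p\<close>; it is \<open>0\<close> for \<open>p = \<infinity>\<close>.\<close>

definition st_recip :: "'v statistic \<Rightarrow> real" where
  "st_recip \<sigma> = real_of_ereal (1 / st_p \<sigma>)"

definition cond :: "('v set \<Rightarrow> real) \<Rightarrow> 'v set \<Rightarrow> 'v set \<Rightarrow> real" where
  "cond h V U = h (U \<union> V) - h U"

text \<open>
  Solutions of the base program are functions on all sets, but only their values on subsets of
  \<open>vars Q\<close> are constrained or enter the objective.
\<close>

definition base_feasible :: "('r, 'v) cquery \<Rightarrow> 'v statistic set \<Rightarrow> ('v set \<Rightarrow> real) set" where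
  "base_feasible Q \<Sigma> = {h.
     (\<forall>U. U \<subseteq> vars Q \<longrightarrow> 0 \<le> h U) \<and>
     (\<forall>\<sigma>\<in>\<Sigma>. st_recip \<sigma> * h (st_U \<sigma>) + cond h (st_V \<sigma>) (st_U \<sigma>) \<le> log 2 (st_b \<sigma>)) \<and>
     h {} = 0 \<and>
     (\<forall>U V. U \<subseteq> vars Q \<longrightarrow> V \<subseteq> vars Q \<longrightarrow> h U \<le> h (U \<union> V)) \<and>
     (\<forall>U V. U \<subseteq> vars Q \<longrightarrow> V \<subseteq> vars Q \<longrightarrow> h (U \<union> V) + h (U \<inter> V) \<le> h U + h V)}"

text \<open>
  Optimal values are taken in the extended reals: \<open>\<infinity>\<close> is the supremum of an unbounded objective
  and the infimum over the empty feasible set.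
\<close>

definition LP_base :: "('r, 'v) cquery \<Rightarrow> 'v statistic set \<Rightarrow> ereal" where
  "LP_base Q \<Sigma> = (SUP h\<in>base_feasible Q \<Sigma>. ereal (h (head Q)))"

definition flow_nodes :: "('r, 'v) cquery \<Rightarrow> 'v statistic set \<Rightarrow> 'v set set" where
  "flow_nodes Q \<Sigma> = {{}} \<union> {{x} | x. x \<in> vars Q} \<union> {st_UV \<sigma> | \<sigma>. \<sigma> \<in> \<Sigma>}"

definition forward_edges :: "'v statistic set \<Rightarrow> ('v set \<times> 'v set) set" where
  "forward_edges \<Sigma> =
     {({}, st_U \<sigma>) | \<sigma>. \<sigma> \<in> \<Sigma> \<and> st_U \<sigma> \<noteq> {}} \<union>
     {(st_U \<sigma>, st_UV \<sigma>) | \<sigma>. \<sigma> \<in> \<Sigma> \<and> st_U \<sigma> \<noteq> st_UV \<sigma>}"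

definition backward_edges :: "'v statistic set \<Rightarrow> ('v set \<times> 'v set) set" where
  "backward_edges \<Sigma> = {(st_UV \<sigma>, {x}) | \<sigma> x. \<sigma> \<in> \<Sigma> \<and> x \<in> st_UV \<sigma> \<and> st_UV \<sigma> \<noteq> {x}}"

definition flow_edges :: "'v statistic set \<Rightarrow> ('v set \<times> 'v set) set" where
  "flow_edges \<Sigma> = forward_edges \<Sigma> \<union> backward_edges \<Sigma>"

text \<open>Capacities of forward edges; backward edges have infinite capacity, that is, no bound.\<close>

definition capacity ::
  "'v statistic set \<Rightarrow> ('v statistic \<Rightarrow> real) \<Rightarrow> 'v set \<Rightarrow> 'v set \<Rightarrow> real" where
  "capacity \<Sigma> w a c =
     (if a = {} then
        (\<Sum>\<sigma> | \<sigma> \<in> \<Sigma> \<and> st_U \<sigma> = {} \<and> st_V \<sigma> = c. w \<sigma>) +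
        (\<Sum>\<sigma> | \<sigma> \<in> \<Sigma> \<and> st_U \<sigma> = c. w \<sigma> * st_recip \<sigma>)
      else (\<Sum>\<sigma> | \<sigma> \<in> \<Sigma> \<and> st_U \<sigma> = a \<and> st_UV \<sigma> = c. w \<sigma>))"

text \<open>
  A solution of the flow program is a pair of the weights \<open>w\<close> and the flows \<open>f\<close>, where \<open>f x a c\<close>
  is the flow of commodity \<open>x\<close> on the edge \<open>(a, c)\<close>; only edges and \<open>x \<in> head Q\<close> matter.
\<close>

definition flow_feasible :: "('r, 'v) cquery \<Rightarrow> 'v statistic set \<Rightarrow>
    (('v statistic \<Rightarrow> real) \<times> ('v \<Rightarrow> 'v set \<Rightarrow> 'v set \<Rightarrow> real)) set" where
  "flow_feasible Q \<Sigma> = {(w, f).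
     (\<forall>\<sigma>\<in>\<Sigma>. 0 \<le> w \<sigma>) \<and>
     (\<forall>x\<in>head Q.
        (\<forall>(a, c)\<in>flow_edges \<Sigma>. 0 \<le> f x a c) \<and>
        (\<forall>c\<in>flow_nodes Q \<Sigma> - {{}}.
           (\<Sum>a | (a, c) \<in> flow_edges \<Sigma>. f x a c) - (\<Sum>d | (c, d) \<in> flow_edges \<Sigma>. f x c d)
             \<ge> (if c = {x} then 1 else 0)) \<and>
        (\<forall>(a, c)\<in>forward_edges \<Sigma>. f x a c \<le> capacity \<Sigma> w a c))}"

definition LP_flow :: "('r, 'v) cquery \<Rightarrow> 'v statistic set \<Rightarrow> ereal" where
  "LP_flow Q \<Sigma> =
     (INF (w, f)\<in>flow_feasible Q \<Sigma>. ereal (\<Sum>\<sigma>\<in>\<Sigma>. w \<sigma> * log 2 (st_b \<sigma>)))"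

end

theory Submission
  imports Defs
begin

text \<open>
  The dual of the flow program assigns to every commodity \<open>x\<close> node potentials \<open>d\<^sub>x\<close> with
  \<open>d\<^sub>x {} = 0\<close>, nonincreasing along backward edges, and maximizes the sum of the \<open>d\<^sub>x {x}\<close>.
  A polymatroid \<open>h\<close> with head \<open>x\<^sub>1, \<dots>, x\<^sub>k\<close> gives the dual solution
  \<open>d\<^sub>i W = I(W; x\<^sub>i | x\<^sub>1, \<dots>, x\<^bsub>i-1\<^esub>)\<close> of value \<open>h {x\<^sub>1, \<dots>, x\<^sub>k}\<close>, and weak duality bounds
  the base program by the flow program. Conversely, a dual solution gives the polymatroid
  \<open>h W = (\<Sum>x. max 0 (MAX y\<in>W. d\<^sub>x {y}))\<close>, which is feasible because \<open>card (st_U \<sigma>) \<le> 1\<close>, and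
  strong duality closes the gap.
\<close>

subsection \<open>Linear programming duality\<close>

text \<open>Bartl's induction: a solution \<open>z\<close> of the old constraints that violates the
  conclusion is used to project onto the kernel of the new constraint.\<close>

lemma farkas:
  fixes A :: "'i \<Rightarrow> 'j \<Rightarrow> real"
  assumes "finite I" and "finite J"
    and "\<And>x. (\<And>i. i \<in> I \<Longrightarrow> (\<Sum>j\<in>J. A i j * x j) \<le> 0) \<Longrightarrow> (\<Sum>j\<in>J. c j * x j) \<le> 0"
  shows "\<exists>y. (\<forall>i\<in>I. 0 \<le> y i) \<and> (\<forall>j\<in>J. c j = (\<Sum>i\<in>I. y i * A i j))"
  using assms(1,3)
proof (induction I arbitrary: A c rule: finite_induct)
  case empty
  \<comment> \<open>With no constraints, \<open>x = c\<close> is an admissible test vector.\<close>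
  have "(\<Sum>j\<in>J. c j * c j) \<le> 0" using empty by simp
  then have "(\<Sum>j\<in>J. c j * c j) = 0" by (simp add: order_antisym sum_nonneg)
  then have "\<forall>j\<in>J. c j = 0" using \<open>finite J\<close> by (simp add: sum_nonneg_eq_0_iff)
  then show ?case by simp
next
  case (insert k I)
  let ?dot = "\<lambda>a x. \<Sum>j\<in>J. a j * x j :: real"
  show ?case
  proof (cases "\<forall>x. (\<forall>i\<in>I. ?dot (A i) x \<le> 0) \<longrightarrow> ?dot c x \<le> 0")
    case True
    then obtain y where y: "\<forall>i\<in>I. 0 \<le> y i" "\<forall>j\<in>J. c j = (\<Sum>i\<in>I. y i * A i j)"
      using insert.IH[of A c] by blast
    have "(\<Sum>i\<in>I. (y(k := 0)) i * A i j) = (\<Sum>i\<in>I. y i * A i j)" for j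
      using insert.hyps by (intro sum.cong) auto
    then show ?thesis
      using y insert.hyps by (intro exI[of _ "y(k := 0)"]) auto
  next
    case False
    then obtain z where z: "\<forall>i\<in>I. ?dot (A i) z \<le> 0" "0 < ?dot c z" by force
    \<comment> \<open>Otherwise \<open>z\<close> would satisfy every constraint, the new one
      included, and contradict \<open>insert.prems\<close>.\<close>
    have kz: "0 < ?dot (A k) z"
      using insert.prems[of z] z by fastforce
    \<comment> \<open>\<open>q a\<close> makes \<open>a - q a * A k\<close> vanish at
      \<open>z\<close>; by \<open>dot_proj\<close> this functional is \<open>a\<close> after
      projection along \<open>z\<close> onto the kernel of \<open>A k\<close>.\<close>
    define q where "q a = ?dot a z / ?dot (A k) z" for a
    have dot_diff: "?dot (\<lambda>j. a j - s * a' j) x = ?dot a x - s * ?dot a' x"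
      "?dot a (\<lambda>j. x j - s * z j) = ?dot a x - s * ?dot a z" for a a' x s
      by (simp_all add: algebra_simps sum_subtractf sum_distrib_left)
    have dot_proj: "?dot (\<lambda>j. a j - q a * A k j) x
        = ?dot a (\<lambda>j. x j - ?dot (A k) x / ?dot (A k) z * z j)" for a x
      unfolding dot_diff by (simp add: q_def)
    have ker: "?dot (A k) (\<lambda>j. x j - ?dot (A k) x / ?dot (A k) z * z j) = 0" for x
      unfolding dot_proj[symmetric] using kz by (simp add: q_def)
    have "?dot (\<lambda>j. c j - q c * A k j) x \<le> 0"
      if "\<And>i. i \<in> I \<Longrightarrow> ?dot (\<lambda>j. A i j - q (A i) * A k j) x \<le> 0" for x
      using that ker unfolding dot_proj by (intro insert.prems) auto
    then obtain y where y: "\<forall>i\<in>I. 0 \<le> y i"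
      "\<forall>j\<in>J. c j - q c * A k j = (\<Sum>i\<in>I. y i * (A i j - q (A i) * A k j))"
      using insert.IH[of "\<lambda>i j. A i j - q (A i) * A k j" "\<lambda>j. c j - q c * A k j"] by blast
    \<comment> \<open>Collecting the multiples of \<open>A k\<close> leaves this multiplier, which
      is nonnegative because \<open>q (A i) \<le> 0 < q c\<close> for the old constraints.\<close>
    define r where "r = q c - (\<Sum>i\<in>I. y i * q (A i))"
    have "(\<Sum>i\<in>I. y i * q (A i)) \<le> 0"
      using y(1) z(1) kz by (intro sum_nonpos mult_nonneg_nonpos) (auto simp: q_def divide_nonpos_pos)
    moreover have "0 < q c" using z(2) kz by (simp add: q_def)
    ultimately have "0 \<le> r" by (simp add: r_def)
    have "c j = r * A k j + (\<Sum>i\<in>I. y i * A i j)" if "j \<in> J" for j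
    proof -
      have "c j - q c * A k j = (\<Sum>i\<in>I. y i * A i j) - (\<Sum>i\<in>I. y i * q (A i)) * A k j"
        using y(2) that by (simp add: algebra_simps sum_subtractf sum_distrib_left)
      then show ?thesis by (simp add: r_def algebra_simps)
    qed
    moreover have "(\<Sum>i\<in>I. (y(k := r)) i * A i j) = (\<Sum>i\<in>I. y i * A i j)" for j
      using insert.hyps by (intro sum.cong) auto
    ultimately show ?thesis
      using y(1) \<open>0 \<le> r\<close> insert.hyps by (intro exI[of _ "y(k := r)"]) auto
  qed
qed

text \<open>Farkas' lemma is applied to the homogenized system, in which a variable \<open>t\<close>
  scales the right-hand side. The feasible point \<open>x0\<close> handles
  \<open>t = 0\<close>.\<close>

lemma lp_strong_duality:
  fixes A :: "'i \<Rightarrow> 'j \<Rightarrow> real"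
  assumes fin: "finite I" "finite J"
    and x0: "\<And>j. j \<in> J \<Longrightarrow> 0 \<le> x0 j" "\<And>i. i \<in> I \<Longrightarrow> (\<Sum>j\<in>J. A i j * x0 j) \<le> b i"
    and bound: "\<And>x. \<lbrakk>\<And>j. j \<in> J \<Longrightarrow> 0 \<le> x j; \<And>i. i \<in> I \<Longrightarrow> (\<Sum>j\<in>J. A i j * x j) \<le> b i\<rbrakk>
      \<Longrightarrow> (\<Sum>j\<in>J. c j * x j) \<le> M"
  shows "\<exists>y. (\<forall>i\<in>I. 0 \<le> y i) \<and> (\<forall>j\<in>J. c j \<le> (\<Sum>i\<in>I. y i * A i j)) \<and> (\<Sum>i\<in>I. y i * b i) \<le> M"
proof -
  let ?dot = "\<lambda>a x. \<Sum>j\<in>J. a j * x j :: real"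
  \<comment> \<open>For \<open>t > 0\<close> divide by \<open>t\<close>. For \<open>t = 0\<close>,
    \<open>x\<close> is a recession direction: the ray from \<open>x0\<close> along \<open>x\<close>
    stays feasible, so the bounded objective cannot grow on it.\<close>
  have hom: "?dot c x \<le> M * t"
    if x: "\<And>j. j \<in> J \<Longrightarrow> 0 \<le> x j" and t: "0 \<le> t" and Ax: "\<And>i. i \<in> I \<Longrightarrow> ?dot (A i) x \<le> b i * t"
    for x t
  proof (cases "t = 0")
    case False
    then have "0 < t" using t by simp
    have "?dot c (\<lambda>j. x j / t) \<le> M"
      using x Ax \<open>0 < t\<close> by (intro bound) (auto simp: sum_divide_distrib[symmetric] pos_divide_le_eq)
    then show ?thesis using \<open>0 < t\<close> by (simp add: sum_divide_distrib[symmetric] pos_divide_le_eq)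
  next
    case True
    have dot: "?dot a (\<lambda>j. x0 j + s * x j) = ?dot a x0 + s * ?dot a x" for a s
      by (simp add: algebra_simps sum.distrib sum_distrib_left)
    have ray: "?dot c x0 + s * ?dot c x \<le> M" if "0 \<le> s" for s
    proof -
      have "?dot c (\<lambda>j. x0 j + s * x j) \<le> M"
      proof (rule bound)
        fix i assume "i \<in> I"
        then have "s * ?dot (A i) x \<le> 0"
          using Ax[of i] True that by (simp add: mult_nonneg_nonpos)
        then show "?dot (A i) (\<lambda>j. x0 j + s * x j) \<le> b i"
          using x0(2)[OF \<open>i \<in> I\<close>] by (simp add: dot)
      qed (use x x0(1) that in auto)
      then show ?thesis by (simp add: dot)
    qed
    have "?dot c x \<le> 0"
    proof (rule ccontr)
      assume "\<not> ?dot c x \<le> 0"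
      then have pos: "0 < ?dot c x" by simp
      \<comment> \<open>The absolute value keeps the step length nonnegative, and the added 1 makes
        the inequality strict.\<close>
      have "M - ?dot c x0 < (\<bar>M - ?dot c x0\<bar> + 1) / ?dot c x * ?dot c x" using pos by simp
      then show False using ray[of "(\<bar>M - ?dot c x0\<bar> + 1) / ?dot c x"] pos by simp
    qed
    then show ?thesis using True by simp
  qed
  \<comment> \<open>The extra column \<open>None\<close> homogenizes the right-hand side; the rows \<open>Inl None\<close> and \<open>Inr j\<close>
    state nonnegativity.\<close>
  define B :: "('i option + 'j) \<Rightarrow> 'j option \<Rightarrow> real" where
    "B r k = (case r of
        Inl (Some i) \<Rightarrow> (case k of None \<Rightarrow> - b i | Some j \<Rightarrow> A i j)
      | Inl None \<Rightarrow> (if k = None then - 1 else 0)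
      | Inr j \<Rightarrow> (if k = Some j then - 1 else 0))" for r k
  define d :: "'j option \<Rightarrow> real" where "d k = (case k of None \<Rightarrow> - M | Some j \<Rightarrow> c j)" for k
  define R where "R = (insert None (Some ` I) <+> J)"
  define K where "K = insert None (Some ` J)"
  have sumK: "(\<Sum>k\<in>K. g k) = g None + (\<Sum>j\<in>J. g (Some j))" for g :: "'j option \<Rightarrow> real"
    using fin by (auto simp: K_def sum.reindex)
  have sumR: "(\<Sum>r\<in>R. g r) = g (Inl None) + (\<Sum>i\<in>I. g (Inl (Some i))) + (\<Sum>j\<in>J. g (Inr j))"
    for g :: "'i option + 'j \<Rightarrow> real"
    using fin by (auto simp: R_def sum.Plus sum.reindex)
  have mem: "Inl None \<in> R" "i \<in> I \<Longrightarrow> Inl (Some i) \<in> R" "j \<in> J \<Longrightarrow> Inr j \<in> R" for i j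
    by (auto simp: R_def)
  have "(\<Sum>k\<in>K. d k * x k) \<le> 0" if x: "\<And>r. r \<in> R \<Longrightarrow> (\<Sum>k\<in>K. B r k * x k) \<le> 0" for x
  proof -
    have "0 \<le> x None" using x[OF mem(1)] by (simp add: sumK B_def)
    moreover have "0 \<le> x (Some j)" if "j \<in> J" for j
    proof -
      have "(\<Sum>k\<in>K. B (Inr j) k * x k) = - x (Some j)"
        using fin(2) that
        by (simp add: sumK B_def if_distrib[of "\<lambda>u. u * _"] sum.delta' cong: if_cong)
      then show ?thesis using x[OF mem(3)[OF that]] by simp
    qed
    moreover have "?dot (A i) (\<lambda>j. x (Some j)) \<le> b i * x None" if "i \<in> I" for i
      using x[OF mem(2)[OF that]] by (simp add: sumK B_def)
    ultimately have "?dot c (\<lambda>j. x (Some j)) \<le> M * x None" by (intro hom) auto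
    then show ?thesis by (simp add: sumK d_def)
  qed
  moreover have "finite R" "finite K" using fin by (auto simp: R_def K_def)
  ultimately obtain y where y: "\<forall>r\<in>R. 0 \<le> y r" "\<forall>k\<in>K. d k = (\<Sum>r\<in>R. y r * B r k)"
    using farkas[of R K B d] by blast
  \<comment> \<open>Column \<open>None\<close> yields \<open>M\<close> up to the slack
    \<open>y (Inl None)\<close>, column \<open>Some j\<close> yields \<open>c j\<close> up to the
    slack \<open>y (Inr j)\<close>; dropping the slacks gives the dual inequalities.\<close>
  have "M = y (Inl None) + (\<Sum>i\<in>I. y (Inl (Some i)) * b i)"
    using y(2)[rule_format, of None] by (simp add: K_def sumR B_def d_def sum_negf)
  moreover have "c j = (\<Sum>i\<in>I. y (Inl (Some i)) * A i j) - y (Inr j)" if "j \<in> J" for j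
    using y(2)[rule_format, of "Some j"] that fin(2)
    by (simp add: K_def sumR B_def d_def if_distrib[of "\<lambda>u. _ * u"] sum.delta cong: if_cong)
  ultimately show ?thesis
    using y(1) by (intro exI[of _ "\<lambda>i. y (Inl (Some i))"]) (auto simp: mem)
qed

subsection \<open>Networks and potentials\<close>

text \<open>The signed incidence matrix: it expresses net inflow as one sum over edges, and its
  transpose sends node potentials to their increments along edges.\<close>

definition incidence :: "'n \<times> 'n \<Rightarrow> 'n \<Rightarrow> real" where
  "incidence e n = of_bool (snd e = n) - of_bool (fst e = n)"

lemma net_inflow_eq_sum_incidence:
  assumes "finite E"
  shows "(\<Sum>a | (a, n) \<in> E. f a n) - (\<Sum>d | (n, d) \<in> E. f n d)
    = (\<Sum>e\<in>E. f (fst e) (snd e) * incidence e n)"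
proof -
  have "(\<Sum>a | (a, n) \<in> E. f a n) = (\<Sum>e | e \<in> E \<and> snd e = n. f (fst e) (snd e))"
    by (rule sum.reindex_bij_witness[of _ fst "\<lambda>a. (a, n)"]) auto
  moreover have "(\<Sum>d | (n, d) \<in> E. f n d) = (\<Sum>e | e \<in> E \<and> fst e = n. f (fst e) (snd e))"
    by (rule sum.reindex_bij_witness[of _ snd "\<lambda>d. (n, d)"]) auto
  ultimately show ?thesis
    using assms
    by (simp add: incidence_def of_bool_def right_diff_distrib sum_subtractf sum.inter_filter
        if_distrib[of "\<lambda>u. _ * u"] cong: if_cong)
qed

text \<open>The node \<open>z\<close> is grounded by \<open>D z = 0\<close>, so leaving out its row,
  which carries no conservation constraint, does not change the sum.\<close>

lemma sum_incidence:
  assumes "finite N" and "e \<in> N \<times> N" and "D z = 0"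
  shows "(\<Sum>n\<in>N - {z}. incidence e n * D n) = D (snd e) - D (fst e)"
proof -
  have "(\<Sum>n\<in>N - {z}. incidence e n * D n) = (\<Sum>n\<in>N. incidence e n * D n)"
    using assms by (intro sum.mono_neutral_left) auto
  also have "\<dots> = (\<Sum>n\<in>N. (if snd e = n then D n else 0)) - (\<Sum>n\<in>N. (if fst e = n then D n else 0))"
    by (auto simp: incidence_def left_diff_distrib simp flip: sum_subtractf intro!: sum.cong)
  finally show ?thesis using assms by (simp add: mem_Times_iff)
qed

text \<open>The coefficient of \<open>w \<sigma>\<close> in the capacity of a forward edge; the same
  matrix, transposed, produces the statistic constraints on potentials.\<close>

definition edge_use :: "'v statistic \<Rightarrow> 'v set \<times> 'v set \<Rightarrow> real" where
  "edge_use \<sigma> e = (if e = ({}, st_U \<sigma>) then st_recip \<sigma> else 0) + of_bool (e = (st_U \<sigma>, st_UV \<sigma>))"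

lemma forward_edges_psubset: "(a, c) \<in> forward_edges \<Sigma> \<Longrightarrow> a \<subset> c"
  by (auto simp: forward_edges_def)

lemma backward_edges_psubset: "(a, c) \<in> backward_edges \<Sigma> \<Longrightarrow> c \<subset> a"
  by (auto simp: backward_edges_def)

lemma finite_forward_edges: "finite \<Sigma> \<Longrightarrow> finite (forward_edges \<Sigma>)"
  by (simp add: forward_edges_def)

text \<open>A forward edge has \<open>c \<noteq> {}\<close>, so the degenerate pair
  \<open>({}, {})\<close> never interferes and the two summands of \<open>edge_use\<close> match the
  two sums in \<open>capacity\<close>.\<close>

lemma capacity_eq_sum_edge_use:
  assumes "finite \<Sigma>" and "(a, c) \<in> forward_edges \<Sigma>"
  shows "capacity \<Sigma> w a c = (\<Sum>\<sigma>\<in>\<Sigma>. w \<sigma> * edge_use \<sigma> (a, c))"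
proof -
  have c: "c \<noteq> {}" using forward_edges_psubset[OF assms(2)] by auto
  show ?thesis
  proof (cases "a = {}")
    case True
    have "w \<sigma> * edge_use \<sigma> (a, c) = (if st_U \<sigma> = {} \<and> st_V \<sigma> = c then w \<sigma> else 0)
        + (if st_U \<sigma> = c then w \<sigma> * st_recip \<sigma> else 0)" for \<sigma>
      using True c by (cases "st_U \<sigma> = {}") (auto simp: edge_use_def)
    then show ?thesis
      using True assms(1) by (simp add: capacity_def sum.inter_filter sum.distrib)
  next
    case False
    have "w \<sigma> * edge_use \<sigma> (a, c) = (if st_U \<sigma> = a \<and> st_UV \<sigma> = c then w \<sigma> else 0)" for \<sigma>
      using False by (auto simp add: edge_use_def eq_commute[of a] eq_commute[of c])
    then show ?thesis
      using False assms(1) by (simp add: capacity_def sum.inter_filter)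
  qed
qed

text \<open>Each omitted edge is degenerate and has potential increment 0, so the sum is the
  left-hand side of the base constraint of \<open>\<sigma>\<close>, with \<open>D\<close> in place
  of \<open>h\<close>.\<close>

lemma sum_forward_edges_edge_use:
  assumes "finite \<Sigma>" and "\<sigma> \<in> \<Sigma>" and "D {} = (0::real)"
  shows "(\<Sum>e\<in>forward_edges \<Sigma>. edge_use \<sigma> e * (D (snd e) - D (fst e)))
    = st_recip \<sigma> * D (st_U \<sigma>) + (D (st_UV \<sigma>) - D (st_U \<sigma>))"
proof -
  let ?F = "forward_edges \<Sigma>" and ?\<Delta> = "\<lambda>e. D (snd e) - D (fst e)"
  have "(\<Sum>e\<in>?F. edge_use \<sigma> e * ?\<Delta> e)
      = (\<Sum>e\<in>?F. (if e = ({}, st_U \<sigma>) then st_recip \<sigma> * ?\<Delta> e else 0))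
        + (\<Sum>e\<in>?F. (if e = (st_U \<sigma>, st_UV \<sigma>) then ?\<Delta> e else 0))"
    by (auto simp: edge_use_def distrib_right simp flip: sum.distrib intro!: sum.cong)
  moreover have "st_U \<sigma> = {}" if "({}, st_U \<sigma>) \<notin> ?F"
    using that assms(2) by (auto simp: forward_edges_def)
  moreover have "st_U \<sigma> = st_UV \<sigma>" if "(st_U \<sigma>, st_UV \<sigma>) \<notin> ?F"
    using that assms(2) unfolding forward_edges_def by blast
  ultimately show ?thesis
    using finite_forward_edges[OF assms(1)] assms(3) by (auto simp: sum.delta)
qed

section \<open>Polymatroids from potentials, and potentials from polymatroids\<close>

definition max_rank :: "('v \<Rightarrow> real) \<Rightarrow> 'v set \<Rightarrow> real" where
  "max_rank d W = Max (insert 0 (d ` W))"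

lemma max_rank_empty [simp]: "max_rank d {} = 0"
  by (simp add: max_rank_def)

lemma max_rank_nonneg: "finite W \<Longrightarrow> 0 \<le> max_rank d W"
  by (simp add: max_rank_def)

lemma max_rank_ge: "finite W \<Longrightarrow> y \<in> W \<Longrightarrow> d y \<le> max_rank d W"
  by (simp add: max_rank_def)

lemma max_rank_le_iff: "finite W \<Longrightarrow> max_rank d W \<le> t \<longleftrightarrow> 0 \<le> t \<and> (\<forall>y\<in>W. d y \<le> t)"
  by (simp add: max_rank_def)

lemma max_rank_mono: "finite W \<Longrightarrow> U \<subseteq> W \<Longrightarrow> max_rank d U \<le> max_rank d W"
  unfolding max_rank_def by (intro Max_mono) auto

text \<open>The value of the union is at most the larger of the two values, that of the intersection
  at most the smaller, and maximum plus minimum is the sum.\<close>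

lemma max_rank_submodular:
  assumes "finite U" and "finite W"
  shows "max_rank d (U \<union> W) + max_rank d (U \<inter> W) \<le> max_rank d U + max_rank d W"
proof -
  have "max_rank d (U \<union> W) \<le> max (max_rank d U) (max_rank d W)"
    using assms max_rank_nonneg[of U d]
    by (subst max_rank_le_iff) (auto simp: le_max_iff_disj max_rank_ge)
  moreover have "max_rank d (U \<inter> W) \<le> min (max_rank d U) (max_rank d W)"
    using assms by (simp add: max_rank_mono)
  ultimately show ?thesis by linarith
qed

text \<open>The potential of the element \<open>x\<close> added after \<open>S\<close> is the mutual information \<open>I(W; x | S)\<close>;
  the sum over \<open>x\<close> telescopes.\<close>

lemma ex_telescoping_potentials:
  fixes h :: "'v set \<Rightarrow> real"
  assumes "finite S" and "S \<subseteq> X" and "h {} = 0"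
    and mono: "\<forall>U W. U \<subseteq> X \<longrightarrow> W \<subseteq> X \<longrightarrow> h U \<le> h (U \<union> W)"
    and submod: "\<forall>U W. U \<subseteq> X \<longrightarrow> W \<subseteq> X \<longrightarrow> h (U \<union> W) + h (U \<inter> W) \<le> h U + h W"
  shows "\<exists>D. (\<forall>x\<in>S. D x {} = 0) \<and> (\<forall>x\<in>S. \<forall>U W. U \<subseteq> W \<longrightarrow> W \<subseteq> X \<longrightarrow> D x U \<le> D x W)
    \<and> (\<Sum>x\<in>S. D x {x}) = h S \<and> (\<forall>W. (\<Sum>x\<in>S. D x W) = h W + h S - h (W \<union> S))"
  using assms(1,2)
proof (induction S rule: finite_induct)
  case empty
  then show ?case using assms(3) by simp
next
  case (insert x S)
  then obtain D where D: "\<forall>y\<in>S. D y {} = 0"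
    "\<forall>y\<in>S. \<forall>U W. U \<subseteq> W \<longrightarrow> W \<subseteq> X \<longrightarrow> D y U \<le> D y W" "(\<Sum>y\<in>S. D y {y}) = h S"
    "\<forall>W. (\<Sum>y\<in>S. D y W) = h W + h S - h (W \<union> S)"
    by auto
  define I where "I W = h (W \<union> S) - h S - h (W \<union> insert x S) + h (insert x S)" for W
  have "I U \<le> I W" if "U \<subseteq> W" "W \<subseteq> X" for U W
  proof -
    \<comment> \<open>The intersection of these sets contains \<open>U \<union> S\<close>, and also
      \<open>x\<close> if \<open>x \<in> W\<close>; monotonicity of \<open>h\<close> covers that
      difference.\<close>
    let ?P = "W \<union> S" and ?R = "U \<union> insert x S"
    have sub: "?P \<subseteq> X" "?R \<subseteq> X" "?P \<inter> ?R \<subseteq> X" "U \<union> S \<subseteq> X"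
      using that insert.prems by auto
    have "h (?P \<union> ?R) + h (?P \<inter> ?R) \<le> h ?P + h ?R"
      using sub by (intro submod[rule_format]) auto
    moreover have "?P \<union> ?R = W \<union> insert x S" using that by auto
    moreover have "h (U \<union> S) \<le> h ((U \<union> S) \<union> (?P \<inter> ?R))" using sub by (intro mono[rule_format]) auto
    moreover have "(U \<union> S) \<union> (?P \<inter> ?R) = ?P \<inter> ?R" using that by auto
    ultimately show ?thesis by (simp add: I_def)
  qed
  moreover have "I {x} = h (insert x S) - h S" "I {} = 0" by (simp_all add: I_def)
  moreover have "(\<Sum>y\<in>S. (D(x := I)) y (g y)) = (\<Sum>y\<in>S. D y (g y))" for g
    using insert.hyps by (intro sum.cong) auto
  ultimately show ?case
    using D insert.hyps by (intro exI[of _ "D(x := I)"]) (auto simp: I_def)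
qed

subsection \<open>Comparison of the two programs\<close>

lemma st_recip_nonneg: "simple_statistic Q \<sigma> \<Longrightarrow> 0 \<le> st_recip \<sigma>"
  by (cases "st_p \<sigma>") (auto simp: st_recip_def simple_statistic_def one_ereal_def zero_ereal_def)

lemma log_st_b_nonneg: "simple_statistic Q \<sigma> \<Longrightarrow> 0 \<le> log 2 (st_b \<sigma>)"
  by (simp add: simple_statistic_def)

lemma simple_statistic_subset:
  assumes "simple_statistic Q \<sigma>"
  shows "st_U \<sigma> \<subseteq> vars Q" and "st_UV \<sigma> \<subseteq> vars Q"
  using assms unfolding simple_statistic_def vars_def by blast+

lemma st_U_cases:
  assumes "conjunctive_query Q" and "simple_statistic Q \<sigma>"
  obtains "st_U \<sigma> = {}" | x where "x \<in> vars Q" "st_U \<sigma> = {x}"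
proof -
  \<comment> \<open>Infinite sets have \<open>card\<close> 0, so finiteness has to be established
    first.\<close>
  have "finite (st_U \<sigma>)"
    using assms finite_subset unfolding conjunctive_query_def simple_statistic_def by metis
  moreover have "card (st_U \<sigma>) = 0 \<or> card (st_U \<sigma>) = 1"
    using assms(2) by (auto simp: simple_statistic_def)
  ultimately consider "st_U \<sigma> = {}" | x where "st_U \<sigma> = {x}"
    by (auto simp: card_1_singleton_iff)
  then show thesis using that simple_statistic_subset[OF assms(2)] by cases auto
qed

lemma finite_vars: "conjunctive_query Q \<Longrightarrow> finite (vars Q)"
  by (auto simp: conjunctive_query_def vars_def)

lemma finite_flow_nodes:
  assumes "conjunctive_query Q" and "finite \<Sigma>"
  shows "finite (flow_nodes Q \<Sigma>)"
  using finite_vars[OF assms(1)] assms(2) by (simp add: flow_nodes_def)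

lemma flow_nodes_subset:
  assumes "\<forall>\<sigma>\<in>\<Sigma>. simple_statistic Q \<sigma>" and "c \<in> flow_nodes Q \<Sigma>"
  shows "c \<subseteq> vars Q"
  using assms(2) simple_statistic_subset(2)[OF assms(1)[rule_format]] by (auto simp: flow_nodes_def)

text \<open>The bound on \<open>card (st_U \<sigma>)\<close> enters here:
  \<open>st_U \<sigma>\<close> is the source or a singleton, hence a node.\<close>

lemma flow_edges_subset:
  assumes "conjunctive_query Q" and "\<forall>\<sigma>\<in>\<Sigma>. simple_statistic Q \<sigma>"
  shows "flow_edges \<Sigma> \<subseteq> flow_nodes Q \<Sigma> \<times> flow_nodes Q \<Sigma>"
proof -
  have U: "st_U \<sigma> \<in> flow_nodes Q \<Sigma>" if "\<sigma> \<in> \<Sigma>" for \<sigma>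
    by (rule st_U_cases[OF assms(1) assms(2)[rule_format, OF that]]) (auto simp: flow_nodes_def)
  have UV: "st_UV \<sigma> \<in> flow_nodes Q \<Sigma>" if "\<sigma> \<in> \<Sigma>" for \<sigma>
    using that by (auto simp: flow_nodes_def)
  have X: "{x} \<in> flow_nodes Q \<Sigma>" if "\<sigma> \<in> \<Sigma>" "x \<in> st_UV \<sigma>" for \<sigma> x
    using that assms(2) simple_statistic_subset(2)[of Q \<sigma>] by (auto simp: flow_nodes_def)
  have "{} \<in> flow_nodes Q \<Sigma>" by (simp add: flow_nodes_def)
  then show ?thesis
    using U UV X unfolding flow_edges_def forward_edges_def backward_edges_def by blast
qed

lemma finite_flow_edges:
  assumes "conjunctive_query Q" and "finite \<Sigma>" and "\<forall>\<sigma>\<in>\<Sigma>. simple_statistic Q \<sigma>"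
  shows "finite (flow_edges \<Sigma>)"
  using finite_subset[OF flow_edges_subset[OF assms(1,3)]] finite_flow_nodes[OF assms(1,2)] by simp

text \<open>Weak duality: the flow of each commodity \<open>x\<close> is paired with the potential
  \<open>D x\<close> obtained from \<open>h\<close>, and summing over the head recovers
  \<open>h (head Q)\<close>.\<close>

lemma base_le_flow:
  assumes Q: "conjunctive_query Q" and fin: "finite \<Sigma>" and simple: "\<forall>\<sigma>\<in>\<Sigma>. simple_statistic Q \<sigma>"
    and h: "h \<in> base_feasible Q \<Sigma>" and wf: "(w, f) \<in> flow_feasible Q \<Sigma>"
  shows "h (head Q) \<le> (\<Sum>\<sigma>\<in>\<Sigma>. w \<sigma> * log 2 (st_b \<sigma>))"
proof -
  let ?S = "head Q" and ?X = "vars Q" and ?N = "flow_nodes Q \<Sigma>"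
  let ?E = "flow_edges \<Sigma>" and ?F = "forward_edges \<Sigma>"
  have S: "finite ?S" "?S \<subseteq> ?X"
    using Q finite_vars[OF Q] finite_subset by (auto simp: conjunctive_query_def)
  have mono: "\<forall>U W. U \<subseteq> ?X \<longrightarrow> W \<subseteq> ?X \<longrightarrow> h U \<le> h (U \<union> W)"
    and submod: "\<forall>U W. U \<subseteq> ?X \<longrightarrow> W \<subseteq> ?X \<longrightarrow> h (U \<union> W) + h (U \<inter> W) \<le> h U + h W"
    using h by (auto simp: base_feasible_def)
  have h0: "h {} = 0" using h by (auto simp: base_feasible_def)
  obtain D where D: "\<forall>x\<in>?S. D x {} = 0"
      "\<forall>x\<in>?S. \<forall>U W. U \<subseteq> W \<longrightarrow> W \<subseteq> ?X \<longrightarrow> D x U \<le> D x W"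
    and Dhead: "(\<Sum>x\<in>?S. D x {x}) = h ?S"
    and Dsum: "\<forall>W. (\<Sum>x\<in>?S. D x W) = h W + h ?S - h (W \<union> ?S)"
    using ex_telescoping_potentials[of ?S ?X h, OF S h0 mono submod]
    by (elim exE conjE) (rule that; assumption)
  have D0: "D x {} = 0" if "x \<in> ?S" for x using D(1) that by simp
  have Dmono: "D x U \<le> D x W" if "x \<in> ?S" "U \<subseteq> W" "W \<subseteq> ?X" for x U W
    using D(2) that by simp
  \<comment> \<open>By \<open>Dsum\<close>, this is the mutual information of \<open>W\<close> and
    the head.\<close>
  define H where "H W = (\<Sum>x\<in>?S. D x W)" for W
  have finE: "finite ?E" and finN: "finite ?N" and finF: "finite ?F"
    using finite_flow_edges[OF Q fin simple] finite_flow_nodes[OF Q fin] finite_forward_edges[OF fin]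
    by simp_all
  note nodes = flow_nodes_subset[OF simple]
  note edges = flow_edges_subset[OF Q simple]
  have FE: "?F \<subseteq> ?E" by (auto simp: flow_edges_def)
  have ends: "fst e \<subseteq> ?X" "snd e \<subseteq> ?X" if "e \<in> ?E" for e
    using subsetD[OF edges that] by (simp_all add: mem_Times_iff nodes)
  \<comment> \<open>Conservation at \<open>c\<close> is weighted with \<open>D x c \<ge> 0\<close>
    and summed. Backward edges then contribute at most 0, and forward flows are bounded by
    capacities.\<close>
  have commodity: "D x {x} \<le> (\<Sum>e\<in>?F. capacity \<Sigma> w (fst e) (snd e) * (D x (snd e) - D x (fst e)))"
    if x: "x \<in> ?S" for x
  proof -
    let ?\<Delta> = "\<lambda>e. D x (snd e) - D x (fst e)"
    have "{x} \<in> ?N - {{}}" using x S by (auto simp: flow_nodes_def)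
    then have "D x {x} = (\<Sum>c\<in>?N - {{}}. (if c = {x} then 1 else 0) * D x c)"
      using finN by (simp add: if_distrib[of "\<lambda>u. u * _"] cong: if_cong)
    also have "\<dots> \<le> (\<Sum>c\<in>?N - {{}}. (\<Sum>e\<in>?E. f x (fst e) (snd e) * incidence e c) * D x c)"
    proof (intro sum_mono mult_right_mono)
      fix c assume c: "c \<in> ?N - {{}}"
      show "(if c = {x} then 1 else 0) \<le> (\<Sum>e\<in>?E. f x (fst e) (snd e) * incidence e c)"
        using wf x c unfolding net_inflow_eq_sum_incidence[OF finE, symmetric]
        by (auto simp: flow_feasible_def)
      show "0 \<le> D x c" using Dmono[OF x, of "{}" c] D0[OF x] nodes c by auto
    qed
    also have "\<dots> = (\<Sum>e\<in>?E. f x (fst e) (snd e) * (\<Sum>c\<in>?N - {{}}. incidence e c * D x c))"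
      unfolding sum_distrib_left sum_distrib_right
      by (subst sum.swap) (simp add: mult.assoc)
    also have "\<dots> = (\<Sum>e\<in>?E. f x (fst e) (snd e) * ?\<Delta> e)"
      using edges finN D0[OF x] by (intro sum.cong refl arg_cong2[where f="(*)"] sum_incidence) auto
    also have "\<dots> = (\<Sum>e\<in>?E - ?F. f x (fst e) (snd e) * ?\<Delta> e) + (\<Sum>e\<in>?F. f x (fst e) (snd e) * ?\<Delta> e)"
      using finE FE by (rule sum.subset_diff[rotated])
    also have "\<dots> \<le> 0 + (\<Sum>e\<in>?F. capacity \<Sigma> w (fst e) (snd e) * ?\<Delta> e)"
    proof (intro add_mono sum_nonpos sum_mono mult_right_mono mult_nonneg_nonpos)
      fix e assume e: "e \<in> ?E - ?F"
      then have "(fst e, snd e) \<in> backward_edges \<Sigma>" by (auto simp: flow_edges_def)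
      then have "snd e \<subseteq> fst e" by (blast dest: backward_edges_psubset)
      then show "?\<Delta> e \<le> 0" using Dmono[OF x _ ends(1)] e by simp
      show "0 \<le> f x (fst e) (snd e)" using wf x e by (auto simp: flow_feasible_def case_prod_beta)
    next
      fix e assume e: "e \<in> ?F"
      then have "(fst e, snd e) \<in> ?F" by simp
      then have "fst e \<subseteq> snd e" by (blast dest: forward_edges_psubset)
      then show "0 \<le> ?\<Delta> e" using Dmono[OF x _ ends(2)[OF subsetD[OF FE e]]] by simp
      show "f x (fst e) (snd e) \<le> capacity \<Sigma> w (fst e) (snd e)"
        using wf x e by (auto simp: flow_feasible_def case_prod_beta)
    qed
    finally show ?thesis by simp
  qed
  have H0: "H {} = 0" using D0 by (simp add: H_def)
  \<comment> \<open>\<open>H\<close> arises from \<open>h\<close> by subtracting the monotone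
    function \<open>h (W \<union> ?S) - h ?S\<close>, which lowers both the value at
    \<open>st_U \<sigma>\<close> and the increment to \<open>st_UV \<sigma>\<close>.\<close>
  have stat: "st_recip \<sigma> * H (st_U \<sigma>) + (H (st_UV \<sigma>) - H (st_U \<sigma>)) \<le> log 2 (st_b \<sigma>)"
    if \<sigma>: "\<sigma> \<in> \<Sigma>" for \<sigma>
  proof -
    note sub = simple_statistic_subset[OF simple[rule_format, OF \<sigma>]]
    have "h ?S \<le> h (st_U \<sigma> \<union> ?S)" using mono[rule_format, of ?S "st_U \<sigma>"] S sub by (simp add: Un_commute)
    then have "H (st_U \<sigma>) \<le> h (st_U \<sigma>)" by (simp add: H_def Dsum)
    then have "st_recip \<sigma> * H (st_U \<sigma>) \<le> st_recip \<sigma> * h (st_U \<sigma>)"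
      using simple \<sigma> by (intro mult_left_mono) (auto intro: st_recip_nonneg)
    moreover have "h (st_U \<sigma> \<union> ?S) \<le> h (st_UV \<sigma> \<union> ?S)"
      using mono[rule_format, of "st_U \<sigma> \<union> ?S" "st_UV \<sigma>"] S sub by (simp add: Un_ac)
    moreover have "st_recip \<sigma> * h (st_U \<sigma>) + (h (st_UV \<sigma>) - h (st_U \<sigma>)) \<le> log 2 (st_b \<sigma>)"
      using h \<sigma> by (auto simp: base_feasible_def cond_def)
    ultimately show ?thesis by (simp add: H_def Dsum)
  qed
  have "h ?S \<le> (\<Sum>x\<in>?S. \<Sum>e\<in>?F. capacity \<Sigma> w (fst e) (snd e) * (D x (snd e) - D x (fst e)))"
    unfolding Dhead[symmetric] by (intro sum_mono commodity)
  also have "\<dots> = (\<Sum>e\<in>?F. capacity \<Sigma> w (fst e) (snd e) * (H (snd e) - H (fst e)))"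
    by (subst sum.swap) (simp add: H_def sum_distrib_left sum_subtractf right_diff_distrib)
  \<comment> \<open>Capacities are expanded by statistic, so that each weight multiplies the
    constraint of its own statistic.\<close>
  also have "\<dots> = (\<Sum>e\<in>?F. (\<Sum>\<sigma>\<in>\<Sigma>. w \<sigma> * edge_use \<sigma> e) * (H (snd e) - H (fst e)))"
    using capacity_eq_sum_edge_use[OF fin] by (intro sum.cong) auto
  also have "\<dots> = (\<Sum>\<sigma>\<in>\<Sigma>. w \<sigma> * (\<Sum>e\<in>?F. edge_use \<sigma> e * (H (snd e) - H (fst e))))"
    unfolding sum_distrib_left sum_distrib_right
    by (subst sum.swap) (simp add: mult.assoc)
  also have "\<dots> \<le> (\<Sum>\<sigma>\<in>\<Sigma>. w \<sigma> * log 2 (st_b \<sigma>))"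
    using wf stat fin H0
    by (intro sum_mono mult_left_mono) (auto simp: sum_forward_edges_edge_use flow_feasible_def)
  finally show ?thesis .
qed

text \<open>\<open>lp_strong_duality\<close> is applied with the potential program as primal, so its
  multipliers are weights and flows. The bound \<open>M\<close> carries over because feasible
  potentials give a member of \<open>base_feasible\<close> with at least the same objective.\<close>

lemma ex_flow_le:
  fixes Q :: "('r, 'v) cquery" and \<Sigma> :: "'v statistic set"
  assumes Q: "conjunctive_query Q" and fin: "finite \<Sigma>" and simple: "\<forall>\<sigma>\<in>\<Sigma>. simple_statistic Q \<sigma>"
    and bound: "\<And>h. h \<in> base_feasible Q \<Sigma> \<Longrightarrow> h (head Q) \<le> M"
  shows "\<exists>w f. (w, f) \<in> flow_feasible Q \<Sigma> \<and> (\<Sum>\<sigma>\<in>\<Sigma>. w \<sigma> * log 2 (st_b \<sigma>)) \<le> M"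
proof -
  let ?S = "head Q" and ?X = "vars Q" and ?N = "flow_nodes Q \<Sigma>"
  let ?E = "flow_edges \<Sigma>" and ?F = "forward_edges \<Sigma>"
  have S: "finite ?S" "?S \<subseteq> ?X"
    using Q finite_vars[OF Q] finite_subset by (auto simp: conjunctive_query_def)
  have finE: "finite ?E" and finN: "finite ?N" and finF: "finite ?F"
    using finite_flow_edges[OF Q fin simple] finite_flow_nodes[OF Q fin] finite_forward_edges[OF fin]
    by simp_all
  have FE: "?F \<subseteq> ?E" by (auto simp: flow_edges_def)
  note edges = flow_edges_subset[OF Q simple]
  \<comment> \<open>Rows are indexed by the weights and the edge flows of the flow program; columns by the node
    potentials of each commodity (the source is grounded) and the lengths of its forward edges.\<close>
  define A :: "'v statistic + 'v \<times> 'v set \<times> 'v set \<Rightarrow> 'v \<times> 'v set + 'v \<times> 'v set \<times> 'v set \<Rightarrow> real"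
    where "A i j = (case i of
        Inl \<sigma> \<Rightarrow> (case j of Inl _ \<Rightarrow> 0 | Inr (_, e) \<Rightarrow> edge_use \<sigma> e)
      | Inr (x, e) \<Rightarrow> (case j of Inl (x', n) \<Rightarrow> of_bool (x = x') * incidence e n
          | Inr (x', e') \<Rightarrow> - of_bool (x = x') * of_bool (e = e')))" for i j
  define b :: "'v statistic + 'v \<times> 'v set \<times> 'v set \<Rightarrow> real"
    where "b i = (case i of Inl \<sigma> \<Rightarrow> log 2 (st_b \<sigma>) | Inr _ \<Rightarrow> 0)" for i
  define c :: "'v \<times> 'v set + 'v \<times> 'v set \<times> 'v set \<Rightarrow> real"
    where "c j = (case j of Inl (x, n) \<Rightarrow> of_bool (n = {x}) | Inr _ \<Rightarrow> 0)" for j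
  define I where "I = \<Sigma> <+> ?S \<times> ?E"
  define J where "J = ?S \<times> (?N - {{}}) <+> ?S \<times> ?F"
  have sumI: "(\<Sum>i\<in>I. g i) = (\<Sum>\<sigma>\<in>\<Sigma>. g (Inl \<sigma>)) + (\<Sum>x\<in>?S. \<Sum>e\<in>?E. g (Inr (x, e)))"
    for g :: "_ \<Rightarrow> real"
    unfolding I_def using S finE fin by (subst sum.Plus) (auto simp: sum.cartesian_product)
  have sumJ: "(\<Sum>j\<in>J. g j)
      = (\<Sum>x\<in>?S. \<Sum>n\<in>?N - {{}}. g (Inl (x, n))) + (\<Sum>x\<in>?S. \<Sum>e\<in>?F. g (Inr (x, e)))"
    for g :: "_ \<Rightarrow> real"
    unfolding J_def using S finN finF by (subst sum.Plus) (auto simp: sum.cartesian_product)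
  have finIJ: "finite I" "finite J" using S finE finF finN fin by (auto simp: I_def J_def)
  have delta: "(\<Sum>x'\<in>?S. of_bool (x = x') * g x') = g x" "(\<Sum>x'\<in>?S. of_bool (x' = x) * g x') = g x"
    if "x \<in> ?S" for x and g :: "_ \<Rightarrow> real"
    using S that by (simp_all add: of_bool_def if_distrib[of "\<lambda>u. u * _"] cong: if_cong)
  have "(\<Sum>j\<in>J. c j * z j) \<le> M"
    if nonneg: "\<And>j. j \<in> J \<Longrightarrow> 0 \<le> z j" and feas: "\<And>i. i \<in> I \<Longrightarrow> (\<Sum>j\<in>J. A i j * z j) \<le> b i" for z
  proof -
    \<comment> \<open>The default 0 grounds the source, which has no column in
      \<open>J\<close>.\<close>
    define D where "D x n = (if n \<in> ?N - {{}} then z (Inl (x, n)) else 0)" for x n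
    define L where "L x e = z (Inr (x, e))" for x e
    have L: "0 \<le> L x e" if "x \<in> ?S" "e \<in> ?F" for x e
      using nonneg[of "Inr (x, e)"] that by (auto simp: L_def J_def)
    have D: "0 \<le> D x n" if "x \<in> ?S" for x n
      using nonneg[of "Inl (x, n)"] that by (auto simp: D_def J_def)
    have D0: "D x {} = 0" for x by (simp add: D_def)
    \<comment> \<open>The row of a forward edge bounds the potential increment by its length; a
      backward edge has no length variable, so its bound is 0.\<close>
    have edge: "D x (snd e) - D x (fst e) \<le> of_bool (e \<in> ?F) * L x e"
      if x: "x \<in> ?S" and e: "e \<in> ?E" for x e
    proof -
      have "(\<Sum>j\<in>J. A (Inr (x, e)) j * z j)
        = (\<Sum>n\<in>?N - {{}}. incidence e n * z (Inl (x, n))) - (\<Sum>e'\<in>?F. of_bool (e = e') * L x e')"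
        using delta(1)[OF x, of "\<lambda>x'. \<Sum>n\<in>?N - {{}}. incidence e n * z (Inl (x', n))"]
          delta(1)[OF x, of "\<lambda>x'. \<Sum>e'\<in>?F. of_bool (e = e') * L x' e'"]
        by (simp add: sumJ A_def L_def mult.assoc sum_negf sum_distrib_left)
      also have "(\<Sum>n\<in>?N - {{}}. incidence e n * z (Inl (x, n))) = (\<Sum>n\<in>?N - {{}}. incidence e n * D x n)"
        by (intro sum.cong) (auto simp: D_def)
      also have "\<dots> = D x (snd e) - D x (fst e)"
        using finN edges e D0 by (intro sum_incidence) auto
      also have "(\<Sum>e'\<in>?F. of_bool (e = e') * L x e') = of_bool (e \<in> ?F) * L x e"
        using finF by (simp add: of_bool_def if_distrib[of "\<lambda>u. u * _"] cong: if_cong)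
      finally show ?thesis using feas[of "Inr (x, e)"] x e by (simp add: I_def b_def InrI)
    qed
    have stat: "(\<Sum>x\<in>?S. \<Sum>e\<in>?F. edge_use \<sigma> e * L x e) \<le> log 2 (st_b \<sigma>)" if "\<sigma> \<in> \<Sigma>" for \<sigma>
      using feas[of "Inl \<sigma>"] that by (simp add: sumJ A_def b_def L_def I_def InlI)
    \<comment> \<open>Backward edges give \<open>D x {y} \<le> D x (st_UV \<sigma>)\<close>, so maximizing over singletons yields
      a polymatroid that is no larger on the sets \<open>st_UV \<sigma>\<close>.\<close>
    define r where "r x W = max_rank (\<lambda>y. D x {y}) W" for x W
    define h where "h W = (\<Sum>x\<in>?S. r x W)" for W
    have fW: "finite W" if "W \<subseteq> ?X" for W using that finite_vars[OF Q] finite_subset by blast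
    \<comment> \<open>Equality matters: \<open>D x (st_U \<sigma>)\<close> enters the constraint
      with coefficient \<open>st_recip \<sigma> - 1\<close>, whose sign depends on
      \<open>p\<close>.\<close>
    have rU: "r x (st_U \<sigma>) = D x (st_U \<sigma>)" if "x \<in> ?S" "\<sigma> \<in> \<Sigma>" for x \<sigma>
      using st_U_cases[OF Q simple[rule_format, OF that(2)]] D[OF that(1)]
      by cases (auto simp: r_def D0 max_rank_def)
    have rUV: "r x (st_UV \<sigma>) \<le> D x (st_UV \<sigma>)" if x: "x \<in> ?S" and \<sigma>: "\<sigma> \<in> \<Sigma>" for x \<sigma>
    proof -
      have "D x {y} \<le> D x (st_UV \<sigma>)" if y: "y \<in> st_UV \<sigma>" for y
      proof (cases "st_UV \<sigma> = {y}")
        case False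
        then have "(st_UV \<sigma>, {y}) \<in> backward_edges \<Sigma>"
          using \<sigma> y by (auto simp: backward_edges_def)
        \<comment> \<open>Forward edges enlarge the set and backward edges shrink it, so the length
          term in \<open>edge\<close> vanishes.\<close>
        moreover from this have "(st_UV \<sigma>, {y}) \<notin> ?F"
          using forward_edges_psubset backward_edges_psubset by blast
        ultimately show ?thesis using edge[OF x, of "(st_UV \<sigma>, {y})"] by (simp add: flow_edges_def)
      qed simp
      then show ?thesis
        using D[OF x] fW[OF simple_statistic_subset(2)[OF simple[rule_format, OF \<sigma>]]]
        by (simp add: r_def max_rank_le_iff)
    qed
    have "h \<in> base_feasible Q \<Sigma>"
      unfolding base_feasible_def
    proof (intro CollectI conjI allI impI ballI)
      fix \<sigma> assume \<sigma>: "\<sigma> \<in> \<Sigma>"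
      have "st_recip \<sigma> * h (st_U \<sigma>) + cond h (st_V \<sigma>) (st_U \<sigma>)
        = (\<Sum>x\<in>?S. st_recip \<sigma> * r x (st_U \<sigma>) + (r x (st_UV \<sigma>) - r x (st_U \<sigma>)))"
        by (simp add: h_def cond_def sum.distrib sum_subtractf sum_distrib_left)
      also have "\<dots> \<le> (\<Sum>x\<in>?S. \<Sum>e\<in>?F. edge_use \<sigma> e * L x e)"
      proof (rule sum_mono)
        fix x assume x: "x \<in> ?S"
        have "st_recip \<sigma> * r x (st_U \<sigma>) + (r x (st_UV \<sigma>) - r x (st_U \<sigma>))
          \<le> st_recip \<sigma> * D x (st_U \<sigma>) + (D x (st_UV \<sigma>) - D x (st_U \<sigma>))"
          using rU[OF x \<sigma>] rUV[OF x \<sigma>] by simp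
        also have "\<dots> = (\<Sum>e\<in>?F. edge_use \<sigma> e * (D x (snd e) - D x (fst e)))"
          using sum_forward_edges_edge_use[OF fin \<sigma>, of "D x"] D0 by simp
        also have "\<dots> \<le> (\<Sum>e\<in>?F. edge_use \<sigma> e * L x e)"
        proof (intro sum_mono mult_left_mono)
          fix e assume e: "e \<in> ?F"
          show "D x (snd e) - D x (fst e) \<le> L x e" using edge[OF x, of e] e FE by auto
          show "0 \<le> edge_use \<sigma> e"
            using st_recip_nonneg[OF simple[rule_format, OF \<sigma>]] by (simp add: edge_use_def)
        qed
        finally show "st_recip \<sigma> * r x (st_U \<sigma>) + (r x (st_UV \<sigma>) - r x (st_U \<sigma>))
          \<le> (\<Sum>e\<in>?F. edge_use \<sigma> e * L x e)" .
      qed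
      also have "\<dots> \<le> log 2 (st_b \<sigma>)" using \<sigma> by (rule stat)
      finally show "st_recip \<sigma> * h (st_U \<sigma>) + cond h (st_V \<sigma>) (st_U \<sigma>) \<le> log 2 (st_b \<sigma>)" .
    next
      fix U W assume "U \<subseteq> ?X" "W \<subseteq> ?X"
      then show "h (U \<union> W) + h (U \<inter> W) \<le> h U + h W"
        unfolding h_def sum.distrib[symmetric] r_def
        by (intro sum_mono max_rank_submodular fW)
    qed (auto simp: h_def r_def fW intro!: sum_nonneg sum_mono max_rank_nonneg max_rank_mono)
    then have "h ?S \<le> M" by (rule bound)
    moreover have "(\<Sum>j\<in>J. c j * z j) = (\<Sum>x\<in>?S. D x {x})"
    proof -
      have "(\<Sum>n\<in>?N - {{}}. of_bool (n = {x}) * z (Inl (x, n))) = D x {x}" for x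
        using finN by (simp add: D_def of_bool_def if_distrib[of "\<lambda>u. u * _"] cong: if_cong)
      then show ?thesis by (simp add: sumJ c_def)
    qed
    \<comment> \<open>Since \<open>x\<close> lies in the head, passing from \<open>D\<close> to
      \<open>h\<close> does not decrease the objective.\<close>
    moreover have "D x {x} \<le> r x ?S" if "x \<in> ?S" for x
      using that S max_rank_ge[of ?S x "\<lambda>y. D x {y}"] by (simp add: r_def)
    ultimately show ?thesis unfolding h_def by (smt (verit) sum_mono)
  qed
  \<comment> \<open>These signs make the zero vector feasible, as the starting point for
    \<open>lp_strong_duality\<close>.\<close>
  moreover have "0 \<le> b i" if "i \<in> I" for i
    using that log_st_b_nonneg[OF simple[rule_format]]
    by (auto simp: I_def b_def simp del: zero_le_log_cancel_iff)
  ultimately obtain y where y: "\<forall>i\<in>I. 0 \<le> y i" "\<forall>j\<in>J. c j \<le> (\<Sum>i\<in>I. y i * A i j)"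
    "(\<Sum>i\<in>I. y i * b i) \<le> M"
    using lp_strong_duality[OF finIJ, of "\<lambda>_. 0" A b c M] by auto
  define w where "w \<sigma> = y (Inl \<sigma>)" for \<sigma>
  define f where "f x a d = y (Inr (x, a, d))" for x a d
  have "(\<Sum>\<sigma>\<in>\<Sigma>. w \<sigma> * log 2 (st_b \<sigma>)) \<le> M"
    using y(3) by (simp add: sumI b_def w_def)
  moreover have "(w, f) \<in> flow_feasible Q \<Sigma>"
  proof -
    \<comment> \<open>The dual inequality for the potential of \<open>x\<close> at \<open>n\<close>
      is flow conservation there.\<close>
    have conserve: "(if n = {x} then 1 else 0) \<le> (\<Sum>e\<in>?E. f x (fst e) (snd e) * incidence e n)"
      if x: "x \<in> ?S" and n: "n \<in> ?N - {{}}" for x n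
    proof -
      have "(\<Sum>i\<in>I. y i * A i (Inl (x, n)))
          = (\<Sum>x'\<in>?S. of_bool (x' = x) * (\<Sum>e\<in>?E. y (Inr (x', e)) * incidence e n))"
        by (simp add: sumI A_def sum_distrib_left mult_ac)
      also have "\<dots> = (\<Sum>e\<in>?E. y (Inr (x, e)) * incidence e n)" by (rule delta(2)[OF x])
      finally show ?thesis
        using y(2)[rule_format, of "Inl (x, n)"] x n by (simp add: J_def c_def f_def InlI of_bool_def)
    qed
    \<comment> \<open>A length has objective coefficient 0, so its dual inequality is the capacity
      bound.\<close>
    have cap: "f x a d \<le> capacity \<Sigma> w a d" if x: "x \<in> ?S" and e: "(a, d) \<in> ?F" for x a d
    proof -
      have "(\<Sum>i\<in>I. y i * A i (Inr (x, a, d))) = (\<Sum>\<sigma>\<in>\<Sigma>. w \<sigma> * edge_use \<sigma> (a, d))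
          - (\<Sum>x'\<in>?S. of_bool (x' = x) * (\<Sum>e\<in>?E. of_bool (e = (a, d)) * y (Inr (x', e))))"
        by (simp add: sumI A_def w_def sum_distrib_left sum_negf mult_ac)
      also have "(\<Sum>x'\<in>?S. of_bool (x' = x) * (\<Sum>e\<in>?E. of_bool (e = (a, d)) * y (Inr (x', e))))
          = (\<Sum>e\<in>?E. of_bool (e = (a, d)) * y (Inr (x, e)))" by (rule delta(2)[OF x])
      also have "\<dots> = f x a d"
        using finE e FE by (auto simp: f_def of_bool_def if_distrib[of "\<lambda>u. u * _"] cong: if_cong)
      finally show ?thesis
        using y(2)[rule_format, of "Inr (x, a, d)"] x e
        by (simp add: J_def c_def InrI capacity_eq_sum_edge_use[OF fin])
    qed
    show ?thesis
      using y(1) conserve cap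
      by (auto simp: flow_feasible_def net_inflow_eq_sum_incidence[OF finE] w_def f_def I_def InlI InrI)
  qed
  ultimately show ?thesis by blast
qed

theorem theorem4p5:
  fixes Q :: "('r, 'v) cquery" and \<Sigma> :: "'v statistic set"
  assumes "conjunctive_query Q"
    and "finite \<Sigma>"
    and "\<forall>\<sigma>\<in>\<Sigma>. simple_statistic Q \<sigma>"
  shows "LP_base Q \<Sigma> = LP_flow Q \<Sigma>"
proof (rule antisym)
  show "LP_base Q \<Sigma> \<le> LP_flow Q \<Sigma>"
    unfolding LP_base_def LP_flow_def
    using base_le_flow[OF assms] by (auto intro!: SUP_least INF_greatest)
  \<comment> \<open>The zero function rules out the value \<open>- \<infinity>\<close>, so only a
    finite supremum needs strong duality.\<close>
  have "(\<lambda>_. 0) \<in> base_feasible Q \<Sigma>"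
    using log_st_b_nonneg[OF assms(3)[rule_format]] by (simp add: base_feasible_def cond_def)
  then have "0 \<le> LP_base Q \<Sigma>"
    unfolding LP_base_def by (rule SUP_upper2) simp
  then consider "LP_base Q \<Sigma> = \<infinity>" | M where "LP_base Q \<Sigma> = ereal M"
    by (cases "LP_base Q \<Sigma>") auto
  then show "LP_flow Q \<Sigma> \<le> LP_base Q \<Sigma>"
  proof cases
    case (2 M)
    have "h (head Q) \<le> M" if "h \<in> base_feasible Q \<Sigma>" for h
      using SUP_upper[OF that, of "\<lambda>h. ereal (h (head Q))"] 2 by (simp add: LP_base_def)
    then obtain w f where "(w, f) \<in> flow_feasible Q \<Sigma>"
      "(\<Sum>\<sigma>\<in>\<Sigma>. w \<sigma> * log 2 (st_b \<sigma>)) \<le> M"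
      using ex_flow_le[OF assms] by blast
    then show ?thesis unfolding 2 LP_flow_def by (intro INF_lower2[of "(w, f)"]) auto
  qed simp
qed

end
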